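(* Let $1\le p,q\le\infty$ with $\frac1p+\frac1q=1$ and let $(\hat y,\hat\eta)\in\mathbb{R}^{n}\times\mathbb{R}$ with $(\hat y,\hat\eta)\notin\mathcal{E}$. Then $d^*_{\ell_p}(\hat y,\hat\eta)$ measures the $\ell_q$-distance from $(\hat y,\hat\eta)$ to $\mathcal{E}$; that is, $$d^*_{\ell_p}(\hat y,\hat\eta)=\min_{(y,\eta)\in\mathcal{E}:\ \eta\ge\hat\eta}\ \|(y-\hat y,\ \eta-\hat\eta)\|_q .$$
   Context: Data: $f\in\mathbb{R}^n$, $c\in\mathbb{R}^{n'}$, $b\in\mathbb{R}^m$, $A\in\mathbb{R}^{m\times n'}$, $B\in\mathbb{R}^{m\times n}$, $Y\subset\mathbb{Z}^n$. Standing assumption: the mixed-integer program $\min\{c^\top x+f^\top y: Ax+By\ge b,\ x\ge0,\ y\in Y\}$ is feasible and bounded. For $y\in\mathbb{R}^n$ let $Q(y)=f^\top y+\min\{c^\top x: Ax\ge b-By,\ x\ge0\}$, and let $\mathrm{dom}(Q)$ be the set of $y\in\mathbb{R}^n$ for which this linear program is feasible. The epigraph is $\mathcal{E}=\{(y,\eta)\in\mathbb{R}^{n+1}: y\in\mathrm{dom}(Q),\ \eta\ge Q(y)\}$. The cone of dual solutions is $\Pi=\{(\pi,\pi_0)\in\mathbb{R}^m\times\mathbb{R}:\pi^\top A\le\pi_0c^\top,\ \pi\ge0,\ \pi_0\ge0\}$. Define $$d^*_{\ell_p}(\hat y,\hat\eta)=\max_{(\pi,\pi_0)\in\Pi}\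 \frac{\pi^\top(b-B\hat y)+\pi_0(f^\top\hat y-\hat\eta)}{\|(\pi^\top B-\pi_0f^\top,\ \pi_0)\|_p},$$ where only $(\pi,\pi_0)\in\Pi$ with nonzero denominator are considered. *)

theory Defs
  imports "HOL-Analysis.Analysis" "HOL-Library.Extended_Real"
begin

text \<open>Vector inequalities are componentwise (the library order on vectors), and
  \<open>\<pi> v* A\<close> is the row vector \<open>\<pi>\<^sup>T A\<close>.  The exponents range over the extended reals, where
  \<open>1 / \<infinity> = 0\<close>.\<close>

text \<open>The norm is taken over the coordinates \<open>x \<bullet> i\<close>.  The standard basis of
  \<open>(real ^ 'n) \<times> real\<close> consists of the standard basis of the first factor and the unit vector
  of the second, so on pairs this is the \<open>p\<close>-norm of the concatenated vector.  The definition
  is meant for \<open>1 \<le> p\<close>; \<open>infnorm\<close> is the maximum of the absolute values of the coordinates.\<close>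

definition lp_norm :: "ereal \<Rightarrow> 'a::euclidean_space \<Rightarrow> real" where
  "lp_norm p x =
     (if p = \<infinity> then infnorm x
      else (\<Sum>i\<in>Basis. \<bar>x \<bullet> i\<bar> powr real_of_ereal p) powr (1 / real_of_ereal p))"

definition is_minimum :: "real set \<Rightarrow> real \<Rightarrow> bool" where
  "is_minimum S v \<longleftrightarrow> v \<in> S \<and> (\<forall>s\<in>S. v \<le> s)"

definition is_maximum :: "real set \<Rightarrow> real \<Rightarrow> bool" where
  "is_maximum S v \<longleftrightarrow> v \<in> S \<and> (\<forall>s\<in>S. s \<le> v)"

definition mip_feasible_set ::
    "real ^ 'm \<Rightarrow> real ^ 'k ^ 'm \<Rightarrow> real ^ 'n ^ 'm \<Rightarrow> (real ^ 'n) set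
      \<Rightarrow> ((real ^ 'k) \<times> (real ^ 'n)) set" where
  "mip_feasible_set b A B Y = {(x, y). A *v x + B *v y \<ge> b \<and> x \<ge> 0 \<and> y \<in> Y}"

definition mip_bounded ::
    "real ^ 'n \<Rightarrow> real ^ 'k \<Rightarrow> real ^ 'm \<Rightarrow> real ^ 'k ^ 'm \<Rightarrow> real ^ 'n ^ 'm
      \<Rightarrow> (real ^ 'n) set \<Rightarrow> bool" where
  "mip_bounded f c b A B Y \<longleftrightarrow>
     bdd_below ((\<lambda>(x, y). c \<bullet> x + f \<bullet> y) ` mip_feasible_set b A B Y)"

definition lp_feasible_set ::
    "real ^ 'm \<Rightarrow> real ^ 'k ^ 'm \<Rightarrow> real ^ 'n ^ 'm \<Rightarrow> real ^ 'n \<Rightarrow> (real ^ 'k) set" where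
  "lp_feasible_set b A B y = {x. A *v x \<ge> b - B *v y \<and> x \<ge> 0}"

definition dom_Q ::
    "real ^ 'm \<Rightarrow> real ^ 'k ^ 'm \<Rightarrow> real ^ 'n ^ 'm \<Rightarrow> (real ^ 'n) set" where
  "dom_Q b A B = {y. lp_feasible_set b A B y \<noteq> {}}"

text \<open>The value is unspecified if the linear program has no optimum.  On \<open>dom_Q\<close> this does not
  happen when the mixed-integer program is feasible and bounded: the dual feasible set does not
  depend on \<open>y\<close> and is then nonempty.\<close>

definition Q_val ::
    "real ^ 'n \<Rightarrow> real ^ 'k \<Rightarrow> real ^ 'm \<Rightarrow> real ^ 'k ^ 'm \<Rightarrow> real ^ 'n ^ 'm
      \<Rightarrow> real ^ 'n \<Rightarrow> real" where
  "Q_val f c b A B y =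
     f \<bullet> y + (THE v. is_minimum ((\<lambda>x. c \<bullet> x) ` lp_feasible_set b A B y) v)"

definition epigraph_Q ::
    "real ^ 'n \<Rightarrow> real ^ 'k \<Rightarrow> real ^ 'm \<Rightarrow> real ^ 'k ^ 'm \<Rightarrow> real ^ 'n ^ 'm
      \<Rightarrow> ((real ^ 'n) \<times> real) set" where
  "epigraph_Q f c b A B = {(y, \<eta>). y \<in> dom_Q b A B \<and> \<eta> \<ge> Q_val f c b A B y}"

definition dual_cone :: "real ^ 'k \<Rightarrow> real ^ 'k ^ 'm \<Rightarrow> ((real ^ 'm) \<times> real) set" where
  "dual_cone c A = {(\<pi>, \<pi>\<^sub>0). \<pi> v* A \<le> \<pi>\<^sub>0 *\<^sub>R c \<and> \<pi> \<ge> 0 \<and> \<pi>\<^sub>0 \<ge> 0}"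

definition cut_ratios ::
    "ereal \<Rightarrow> real ^ 'n \<Rightarrow> real ^ 'k \<Rightarrow> real ^ 'm \<Rightarrow> real ^ 'k ^ 'm \<Rightarrow> real ^ 'n ^ 'm
      \<Rightarrow> real ^ 'n \<Rightarrow> real \<Rightarrow> real set" where
  "cut_ratios p f c b A B yh \<eta>h =
     {(\<pi> \<bullet> (b - B *v yh) + \<pi>\<^sub>0 * (f \<bullet> yh - \<eta>h)) / lp_norm p (\<pi> v* B - \<pi>\<^sub>0 *\<^sub>R f, \<pi>\<^sub>0) | \<pi> \<pi>\<^sub>0.
        (\<pi>, \<pi>\<^sub>0) \<in> dual_cone c A \<and> lp_norm p (\<pi> v* B - \<pi>\<^sub>0 *\<^sub>R f, \<pi>\<^sub>0) \<noteq> 0}"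

definition d_star ::
    "ereal \<Rightarrow> real ^ 'n \<Rightarrow> real ^ 'k \<Rightarrow> real ^ 'm \<Rightarrow> real ^ 'k ^ 'm \<Rightarrow> real ^ 'n ^ 'm
      \<Rightarrow> real ^ 'n \<Rightarrow> real \<Rightarrow> real" where
  "d_star p f c b A B yh \<eta>h = (THE v. is_maximum (cut_ratios p f c b A B yh \<eta>h) v)"

end

(*
  By Farkas' lemma the epigraph is the intersection of the half-spaces
  pi^T b <= a . z with a = (pi^T B - pi_0 f^T, pi_0) and (pi, pi_0) in the dual cone; in particular
  it is closed, so the distance d is attained.  Hoelder's inequality bounds every cut ratio by d.
  Conversely, separate the epigraph from the open l_q-ball of radius d around the given point.  By
  Farkas' lemma again, the separating inequality is dominated by one of the cuts above, with the
  same normal vector a; as the maximum of a over the l_q-ball is d times the l_p-norm of a, its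
  ratio is at least d.  Raising eta towards eta_hat never increases the distance, so the constraint
  eta >= eta_hat is harmless.
*)
theory Submission
  imports Defs
begin

subsection \<open>Conjugate norms\<close>

text \<open>The pairs containing infinity are split off because \<open>lp_norm\<close> is a maximum
  there; in the remaining case both exponents are reals strictly above 1, as Young's inequality
  requires.\<close>

lemma conjugate_exponent_cases:
  fixes p q :: ereal
  assumes "1 \<le> p" "1 \<le> q" "1 / p + 1 / q = 1"
  obtains "p = 1" "q = \<infinity>" | "p = \<infinity>" "q = 1"
    | r s where "p = ereal r" "q = ereal s" "1 < r" "1 < s" "1 / r + 1 / s = 1"
proof (cases p; cases q)
  fix r s assume rs: "p = ereal r" "q = ereal s"
  with assms have "1 \<le> r" "1 \<le> s" by auto
  moreover from this have e: "1 / r + 1 / s = 1"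
    using assms(3) unfolding rs one_ereal_def by simp
  moreover have "r \<noteq> 1" "s \<noteq> 1" using e \<open>1 \<le> r\<close> \<open>1 \<le> s\<close> by auto
  ultimately show thesis using rs that(3) by force
next
  fix r assume r: "p = ereal r" "q = \<infinity>"
  with assms have "1 \<le> r" by auto
  moreover have "1 / r = 1" using assms(3) \<open>1 \<le> r\<close> unfolding r one_ereal_def by simp
  ultimately show thesis using r that(1) by (simp add: one_ereal_def)
next
  fix s assume s: "p = \<infinity>" "q = ereal s"
  with assms have "1 \<le> s" by auto
  moreover have "1 / s = 1" using assms(3) \<open>1 \<le> s\<close> unfolding s one_ereal_def by simp
  ultimately show thesis using s that(2) by (simp add: one_ereal_def)
qed (use assms in auto)

section \<open>Elementary properties of the l_p norm\<close>

lemma lp_norm_1: "lp_norm 1 x = (\<Sum>i\<in>Basis. \<bar>x \<bullet> i\<bar>)"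
  by (simp add: lp_norm_def sum_nonneg one_ereal_def)

lemma lp_norm_ereal:
  "lp_norm (ereal r) x = (\<Sum>i\<in>Basis. \<bar>x \<bullet> i\<bar> powr r) powr (1 / r)"
  by (simp add: lp_norm_def)

lemma lp_norm_nonneg: "0 \<le> lp_norm p x"
  by (simp add: lp_norm_def infnorm_pos_le)

lemma lp_norm_mono:
  assumes "1 \<le> p" "\<And>i. i \<in> Basis \<Longrightarrow> \<bar>x \<bullet> i\<bar> \<le> \<bar>y \<bullet> i\<bar>"
  shows "lp_norm p x \<le> lp_norm p y"
proof (cases p)
  case (real r)
  with assms(1) have "1 \<le> r" by auto
  then show ?thesis unfolding real lp_norm_ereal using assms(2)
    by (intro powr_mono2 sum_mono sum_nonneg) auto
next
  case PInf
  have "\<bar>x \<bullet> i\<bar> \<le> infnorm y" if "i \<in> Basis" for i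
    using assms(2)[OF that] Basis_le_infnorm[OF that, of y] by linarith
  then show ?thesis by (simp add: PInf lp_norm_def infnorm_Max[of x])
qed (use assms in auto)

lemma lp_norm_scaleR:
  assumes "1 \<le> p"
  shows "lp_norm p (t *\<^sub>R x) = \<bar>t\<bar> * lp_norm p x"
proof (cases p)
  case (real r)
  with assms(1) have r: "1 \<le> r" by auto
  have "(\<Sum>i\<in>Basis. \<bar>(t *\<^sub>R x) \<bullet> i\<bar> powr r) = \<bar>t\<bar> powr r * (\<Sum>i\<in>Basis. \<bar>x \<bullet> i\<bar> powr r)"
    by (simp add: abs_mult powr_mult sum_distrib_left)
  then show ?thesis unfolding real lp_norm_ereal using r
    by (simp add: powr_mult sum_nonneg powr_powr)
qed (use assms in \<open>auto simp: lp_norm_def infnorm_mul\<close>)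

text \<open>One summand is at most the whole sum. Definiteness and a Euclidean bound then carry over
  from \<open>infnorm\<close> to every \<open>p\<close>.\<close>

lemma infnorm_le_lp_norm:
  assumes "1 \<le> p"
  shows "infnorm x \<le> lp_norm p x"
proof (cases p)
  case (real r)
  with assms(1) have r: "1 \<le> r" by auto
  have "\<bar>x \<bullet> i\<bar> \<le> lp_norm p x" if "i \<in> Basis" for i
  proof -
    have "\<bar>x \<bullet> i\<bar> = (\<bar>x \<bullet> i\<bar> powr r) powr (1 / r)" using r by (simp add: powr_powr)
    also have "\<dots> \<le> lp_norm p x" unfolding real lp_norm_ereal
      using r that by (intro powr_mono2 member_le_sum) auto
    finally show ?thesis .
  qed
  then show ?thesis by (simp add: infnorm_Max)
qed (use assms in \<open>auto simp: lp_norm_def\<close>)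

lemma lp_norm_eq_0_iff:
  assumes "1 \<le> p"
  shows "lp_norm p x = 0 \<longleftrightarrow> x = 0"
  using infnorm_le_lp_norm[OF assms, of x] infnorm_pos_lt[of x] lp_norm_scaleR[OF assms, of 0 x]
  by fastforce

lemma lp_norm_pos:
  assumes "1 \<le> p" "x \<noteq> 0"
  shows "0 < lp_norm p x"
  using lp_norm_nonneg[of p x] lp_norm_eq_0_iff[OF assms(1), of x] assms(2) by linarith

lemma norm_le_lp_norm:
  fixes x :: "'a::euclidean_space"
  assumes "1 \<le> p"
  shows "norm x \<le> sqrt DIM('a) * lp_norm p x"
  using norm_le_infnorm[of x] infnorm_le_lp_norm[OF assms, of x]
  by (meson mult_left_mono order_trans real_sqrt_ge_zero of_nat_0_le_iff)

lemma continuous_on_lp_norm: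
  fixes S :: "'a::euclidean_space set"
  assumes "1 \<le> p"
  shows "continuous_on S (lp_norm p)"
proof (cases p)
  case (real r)
  with assms(1) have r: "1 \<le> r" by auto
  then show ?thesis unfolding real lp_norm_ereal
    by (intro continuous_on_powr' continuous_intros) (auto intro: sum_nonneg)
next
  case PInf
  then show ?thesis by (simp add: lp_norm_def continuous_on_infnorm continuous_on_id)
qed (use assms in auto)

section \<open>Hoelder's inequality, its equality case, and convexity of balls\<close>

lemma inner_le_sum_abs: "x \<bullet> y \<le> (\<Sum>i\<in>Basis. \<bar>x \<bullet> i\<bar> * \<bar>y \<bullet> i\<bar>)"
  by (subst euclidean_inner, rule sum_mono) (simp add: flip: abs_mult)

text \<open>For the pair 1 and infinity, each coordinate of one vector is bounded by its maximum.
  Otherwise Young's inequality is summed over the coordinates divided by the norms, where the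
  right-hand sides add up to \<open>1 / r + 1 / s = 1\<close>.\<close>

lemma inner_le_lp_norm:
  fixes x y :: "'a::euclidean_space"
  assumes pq: "1 \<le> p" "1 \<le> q" "1 / p + 1 / q = 1"
  shows "x \<bullet> y \<le> lp_norm p x * lp_norm q y"
proof -
  have L1: "u \<bullet> v \<le> lp_norm 1 u * lp_norm \<infinity> v" for u v :: 'a
  proof -
    have "u \<bullet> v \<le> (\<Sum>i\<in>Basis. \<bar>u \<bullet> i\<bar> * infnorm v)"
      by (rule order_trans[OF inner_le_sum_abs]) (intro sum_mono mult_left_mono Basis_le_infnorm, auto)
    then show ?thesis by (simp add: lp_norm_1 sum_distrib_right) (simp add: lp_norm_def)
  qed
  show ?thesis
  proof (cases rule: conjugate_exponent_cases[OF pq])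
    case 1
    then show ?thesis using L1 by simp
  next
    case 2
    then show ?thesis using L1[of y x] by (simp add: inner_commute mult.commute)
  next
    case (3 r s)
    show ?thesis
    proof (cases "x = 0 \<or> y = 0")
      case True
      then show ?thesis by (auto simp: lp_norm_nonneg)
    next
      case False
      define X where "X = lp_norm p x"
      define Y where "Y = lp_norm q y"
      have pos: "X > 0" "Y > 0"
        using False pq by (auto simp: X_def Y_def intro: lp_norm_pos)
      have sX: "(\<Sum>i\<in>Basis. \<bar>x \<bullet> i\<bar> powr r) = X powr r"
        unfolding X_def 3 lp_norm_ereal using 3 by (simp add: powr_powr sum_nonneg)
      have sY: "(\<Sum>i\<in>Basis. \<bar>y \<bullet> i\<bar> powr s) = Y powr s"
        unfolding Y_def 3 lp_norm_ereal using 3 by (simp add: powr_powr sum_nonneg)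
      have "(\<Sum>i\<in>Basis. (\<bar>x \<bullet> i\<bar> / X) * (\<bar>y \<bullet> i\<bar> / Y))
          \<le> (\<Sum>i\<in>Basis. (\<bar>x \<bullet> i\<bar> / X) powr r / r + (\<bar>y \<bullet> i\<bar> / Y) powr s / s)"
        using 3 pos by (intro sum_mono Youngs_inequality) auto
      also have "\<dots> = (\<Sum>i\<in>Basis. \<bar>x \<bullet> i\<bar> powr r) / X powr r / r
          + (\<Sum>i\<in>Basis. \<bar>y \<bullet> i\<bar> powr s) / Y powr s / s"
        using pos by (simp add: powr_divide sum.distrib sum_divide_distrib)
      also have "\<dots> = 1" using pos 3 by (simp add: sX sY)
      finally have "(\<Sum>i\<in>Basis. \<bar>x \<bullet> i\<bar> * \<bar>y \<bullet> i\<bar>) / (X * Y) \<le> 1"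
        by (simp add: sum_divide_distrib)
      then have "(\<Sum>i\<in>Basis. \<bar>x \<bullet> i\<bar> * \<bar>y \<bullet> i\<bar>) \<le> X * Y" using pos by simp
      then show ?thesis using inner_le_sum_abs[of x y] by (simp add: X_def Y_def)
    qed
  qed
qed

text \<open>Hoelder's inequality is sharp: the sign vector of \<open>x\<close> serves for
  \<open>p = 1\<close>, a signed unit vector at a largest coordinate for
  \<open>p = \<infinity>\<close>, and signed powers of the coordinates in between.\<close>

lemma lp_norm_dual_attained:
  fixes x :: "'a::euclidean_space"
  assumes pq: "1 \<le> p" "1 \<le> q" "1 / p + 1 / q = 1"
  obtains v where "x \<bullet> v = lp_norm p x" "lp_norm q v \<le> 1"
proof (cases rule: conjugate_exponent_cases[OF pq])
  case 1
  define v where "v = (\<Sum>i\<in>Basis. sgn (x \<bullet> i) *\<^sub>R i)"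
  have vi: "v \<bullet> i = sgn (x \<bullet> i)" if "i \<in> Basis" for i
    using that by (simp add: v_def)
  show thesis
  proof
    show "x \<bullet> v = lp_norm p x" unfolding 1 lp_norm_1
      by (subst euclidean_inner) (simp add: vi abs_sgn)
    have "\<bar>sgn t\<bar> \<le> 1" for t :: real by (simp add: sgn_if)
    then show "lp_norm q v \<le> 1" by (simp add: 1 lp_norm_def infnorm_Max vi)
  qed
next
  case 2
  have "infnorm x \<in> (\<lambda>i. \<bar>x \<bullet> i\<bar>) ` Basis" unfolding infnorm_Max by (intro Max_in) auto
  then obtain j where j: "j \<in> Basis" "infnorm x = \<bar>x \<bullet> j\<bar>" by auto
  show thesis
  proof
    show "x \<bullet> (sgn (x \<bullet> j) *\<^sub>R j) = lp_norm p x"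
      using j by (simp add: 2 lp_norm_def abs_sgn mult.commute)
    have "lp_norm q j = 1" using j by (simp add: 2 lp_norm_1 inner_Basis if_distrib cong: if_cong)
    then show "lp_norm q (sgn (x \<bullet> j) *\<^sub>R j) \<le> 1"
      using pq by (simp add: lp_norm_scaleR sgn_if)
  qed
next
  case (3 r s)
  show thesis
  proof (cases "x = 0")
    case True
    then show thesis using that[of 0] lp_norm_eq_0_iff[OF pq(1), of 0] lp_norm_eq_0_iff[OF pq(2), of "0 :: 'a"] by simp
  next
    case False
    define X where "X = lp_norm p x"
    have X: "X > 0"
      using False pq by (auto simp: X_def intro: lp_norm_pos)
    have sX: "(\<Sum>i\<in>Basis. \<bar>x \<bullet> i\<bar> powr r) = X powr r"
      unfolding X_def 3 lp_norm_ereal using 3 by (simp add: powr_powr sum_nonneg)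
    \<comment> \<open>The power \<open>r - 1\<close> is the equality case of Young's inequality;
      since \<open>(r - 1) * s = r\<close>, the \<open>s\<close>-th powers of the coordinates of
      \<open>v\<close> sum to 1.\<close>
    define v where "v = (\<Sum>i\<in>Basis. (sgn (x \<bullet> i) * (\<bar>x \<bullet> i\<bar> / X) powr (r - 1)) *\<^sub>R i)"
    have vi: "v \<bullet> i = sgn (x \<bullet> i) * (\<bar>x \<bullet> i\<bar> / X) powr (r - 1)" if "i \<in> Basis" for i
      using that by (simp add: v_def)
    have rs: "(r - 1) * s = r" using 3 by (simp add: field_simps)
    have term1: "(x \<bullet> i) * (v \<bullet> i) = \<bar>x \<bullet> i\<bar> powr r / X powr (r - 1)" if "i \<in> Basis" for i
    proof -
      have "(x \<bullet> i) * (v \<bullet> i) = \<bar>x \<bullet> i\<bar> * \<bar>x \<bullet> i\<bar> powr (r - 1) / X powr (r - 1)"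
        using X by (simp add: vi that powr_divide abs_sgn)
      also have "\<bar>x \<bullet> i\<bar> * \<bar>x \<bullet> i\<bar> powr (r - 1) = \<bar>x \<bullet> i\<bar> powr r"
        by (cases "x \<bullet> i = 0") (auto simp: powr_mult_base)
      finally show ?thesis .
    qed
    have term2: "\<bar>v \<bullet> i\<bar> powr s = \<bar>x \<bullet> i\<bar> powr r / X powr r" if "i \<in> Basis" for i
    proof (cases "x \<bullet> i = 0")
      case False
      then show ?thesis using X
        by (simp add: vi that abs_mult abs_sgn_eq powr_powr rs powr_divide)
    qed (simp add: vi that)
    show thesis
    proof
      have "x \<bullet> v = X powr r / X powr (r - 1)"
        by (subst euclidean_inner) (simp add: term1 sX flip: sum_divide_distrib)
      also have "\<dots> = X" using X by (simp flip: powr_diff)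
      finally show "x \<bullet> v = lp_norm p x" by (simp add: X_def)
      show "lp_norm q v \<le> 1" unfolding 3 lp_norm_ereal
        using X by (simp add: term2 sX flip: sum_divide_distrib)
    qed
  qed
qed

text \<open>The triangle inequality comes from duality: some \<open>w\<close> with
  \<open>lp_norm p w \<le> 1\<close> attains the q-norm of the convex combination, which turns that
  norm into a linear expression to be bounded term by term.\<close>

lemma convex_lp_ball:
  assumes pq: "1 \<le> p" "1 \<le> q" "1 / p + 1 / q = 1"
  shows "convex {x :: 'a::euclidean_space. lp_norm q (x - z) < d}"
proof (rule convexI)
  have qp: "1 \<le> q" "1 \<le> p" "1 / q + 1 / p = 1" using pq by (auto simp: add.commute)
  fix x y :: 'a and u v :: real
  assume x: "x \<in> {x. lp_norm q (x - z) < d}" and y: "y \<in> {x. lp_norm q (x - z) < d}"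
    and uv: "0 \<le> u" "0 \<le> v" "u + v = 1"
  have e: "u *\<^sub>R x + v *\<^sub>R y - z = u *\<^sub>R (x - z) + v *\<^sub>R (y - z)"
    using uv(3) by (simp add: algebra_simps flip: scaleR_add_left)
  obtain w where w: "(u *\<^sub>R x + v *\<^sub>R y - z) \<bullet> w = lp_norm q (u *\<^sub>R x + v *\<^sub>R y - z)"
      "lp_norm p w \<le> 1"
    using lp_norm_dual_attained[OF qp] by blast
  have le: "a \<bullet> w \<le> lp_norm q a" for a
    using inner_le_lp_norm[OF qp, of a w] w(2) lp_norm_nonneg[of q a]
    by (meson mult_left_le order_trans)
  have "lp_norm q (u *\<^sub>R x + v *\<^sub>R y - z) = u * ((x - z) \<bullet> w) + v * ((y - z) \<bullet> w)"
    by (subst w(1)[symmetric], subst e) (simp add: inner_add_left)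
  also have "\<dots> \<le> u * lp_norm q (x - z) + v * lp_norm q (y - z)"
    using uv le by (intro add_mono mult_left_mono) auto
  also have "\<dots> < d" using x y uv by (intro convex_bound_lt) auto
  finally show "u *\<^sub>R x + v *\<^sub>R y \<in> {x. lp_norm q (x - z) < d}" by simp
qed

subsection \<open>Farkas' lemma\<close>

text \<open>Exhibits the orthant as a finitely generated cone, a property that linear maps
  preserve.\<close>

lemma nonneg_orthant_eq_cone_hull:
  "{x :: 'a::ordered_euclidean_space. 0 \<le> x} = convex_cone hull Basis"
proof
  have nn: "0 \<le> x \<bullet> i" if "0 \<le> x" "i \<in> Basis" for x i :: 'a
    using that by (simp add: eucl_le[where 'a='a])
  have "x \<in> convex_cone hull Basis" if "0 \<le> x" for x :: 'a
  proof -
    have "(\<Sum>i\<in>F. (x \<bullet> i) *\<^sub>R i) \<in> convex_cone hull Basis" if "finite F" "F \<subseteq> Basis" for F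
      using that
    proof (induction F)
      case (insert i F)
      then show ?case using nn[OF \<open>0 \<le> x\<close>]
        by (auto intro: convex_cone_hull_add convex_cone_hull_mul hull_inc)
    qed (simp add: convex_cone_hull_contains_0)
    from this[of Basis] show ?thesis by (simp add: euclidean_representation)
  qed
  then show "{x :: 'a. 0 \<le> x} \<subseteq> convex_cone hull Basis" by auto
  have "convex_cone {x :: 'a. 0 \<le> x}"
    by (auto simp: convex_cone_iff intro: scaleR_nonneg_nonneg)
  then show "convex_cone hull Basis \<subseteq> {x :: 'a. 0 \<le> x}"
    by (intro hull_minimal) (auto simp: eucl_le[where 'a='a] inner_Basis)
qed

text \<open>A linear image of a closed cone need not be closed; this one is generated by the
  finitely many images of the basis vectors and hence is a polyhedron.\<close>

lemma closed_convex_cone_image_orthant: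
  fixes h :: "'a::ordered_euclidean_space \<Rightarrow> 'b::euclidean_space"
  assumes "linear h"
  shows "closed (h ` {x. 0 \<le> x})" "convex_cone (h ` {x. 0 \<le> x})"
  unfolding nonneg_orthant_eq_cone_hull convex_cone_hull_linear_image[OF assms, symmetric]
  by (auto intro!: polyhedron_imp_closed polyhedron_convex_cone_hull convex_cone_convex_cone_hull)

text \<open>The point is strictly separated from the closed cone; invariance of the cone under
  scaling then lets the separating level be moved to 0.\<close>

lemma farkas_cone:
  fixes h :: "'a::ordered_euclidean_space \<Rightarrow> 'b::euclidean_space"
  assumes "linear h" "z \<notin> h ` {x. 0 \<le> x}"
  obtains w where "w \<bullet> z < 0" "\<And>x. 0 \<le> x \<Longrightarrow> 0 \<le> w \<bullet> h x"
proof -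
  let ?C = "h ` {x. 0 \<le> x}"
  note C = closed_convex_cone_image_orthant[OF assms(1)]
  obtain w \<beta> where w: "w \<bullet> z < \<beta>" "\<And>y. y \<in> ?C \<Longrightarrow> \<beta> < w \<bullet> y"
    using separating_hyperplane_closed_point[of ?C z] C assms(2)
    by (auto simp: convex_cone_def)
  have "\<beta> < 0" using w(2)[of 0] convex_cone_contains_0[OF C(2)] by simp
  have "0 \<le> w \<bullet> y" if "y \<in> ?C" for y
  proof (rule ccontr)
    assume neg: "\<not> 0 \<le> w \<bullet> y"
    \<comment> \<open>The factor is positive and moves \<open>y\<close> exactly onto the level
      \<beta>, where no point of the cone lies.\<close>
    have "(\<beta> / (w \<bullet> y)) *\<^sub>R y \<in> ?C"
      using neg \<open>\<beta> < 0\<close> by (intro convex_cone_scaleR[OF C(2) _ that]) (simp add: divide_nonpos_neg)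
    from w(2)[OF this] neg show False by simp
  qed
  with w \<open>\<beta> < 0\<close> show thesis by (intro that[of w]) auto
qed

text \<open>Self-duality of the orthant; it turns the sign conditions produced by
  \<open>farkas_cone\<close> into vector inequalities.\<close>

lemma eucl_nonneg_iff_inner:
  fixes w :: "'a::ordered_euclidean_space"
  shows "0 \<le> w \<longleftrightarrow> (\<forall>x\<ge>0. 0 \<le> w \<bullet> x)"
proof
  show "\<forall>x\<ge>0. 0 \<le> w \<bullet> x" if "0 \<le> w"
  proof (intro allI impI)
    fix x :: 'a assume "0 \<le> x"
    with that have "0 \<le> (w \<bullet> i) * (x \<bullet> i)" if "i \<in> Basis" for i
      using \<open>i \<in> Basis\<close> by (simp add: eucl_le[where 'a='a])
    then show "0 \<le> w \<bullet> x" by (subst euclidean_inner) (rule sum_nonneg)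
  qed
  show "0 \<le> w" if "\<forall>x\<ge>0. 0 \<le> w \<bullet> x"
  proof -
    have "0 \<le> i" if "i \<in> Basis" for i :: 'a using that by (simp add: eucl_le[where 'a='a] inner_Basis)
    with that show ?thesis by (simp add: eucl_le[where 'a='a])
  qed
qed

text \<open>With a slack \<open>s\<close>, solvability means that \<open>- d\<close> lies in the
  cone of all \<open>s - G x\<close>. The separating vector, tested on pure slacks and on pure
  \<open>x\<close>, is the certificate.\<close>

lemma farkas_infeasible:
  fixes G :: "'a::ordered_euclidean_space \<Rightarrow> 'b::ordered_euclidean_space"
  assumes G: "linear G" and inf: "\<nexists>x. 0 \<le> x \<and> d \<le> G x"
  obtains w where "0 \<le> w" "adjoint G w \<le> 0" "0 < w \<bullet> d"
proof -
  have lin: "linear (\<lambda>(x, s). s - G x)"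
    by (auto simp: linear_iff linear_add[OF G] linear_scale[OF G] algebra_simps)
  have "- d \<notin> (\<lambda>(x, s). s - G x) ` {z. 0 \<le> z}"
  proof
    assume "- d \<in> (\<lambda>(x, s). s - G x) ` {z. 0 \<le> z}"
    then obtain x s where "0 \<le> x" "0 \<le> s" "- d = s - G x" by (auto simp: zero_prod_def)
    then have "G x - d = s" by (simp add: algebra_simps)
    then have "d \<le> G x" using \<open>0 \<le> s\<close> by (metis diff_ge_0_iff_ge)
    with inf \<open>0 \<le> x\<close> show False by blast
  qed
  from farkas_cone[OF lin this] obtain w
    where w: "w \<bullet> (- d) < 0" "\<And>z. 0 \<le> z \<Longrightarrow> 0 \<le> w \<bullet> (case z of (x, s) \<Rightarrow> s - G x)" by blast
  show thesis
  proof (rule that[of w])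
    show "0 < w \<bullet> d" using w(1) by simp
    have "0 \<le> w \<bullet> s" if "0 \<le> s" for s
      using w(2)[of "(0, s)"] that by (simp add: zero_prod_def linear_0[OF G])
    then show "0 \<le> w" by (subst eucl_nonneg_iff_inner) blast
    have "0 \<le> - adjoint G w \<bullet> x" if "0 \<le> x" for x
      using w(2)[of "(x, 0)"] that by (simp add: zero_prod_def adjoint_clauses[OF G])
    then have "0 \<le> - adjoint G w" by (subst eucl_nonneg_iff_inner) blast
    then show "adjoint G w \<le> 0" by simp
  qed
qed

text \<open>Affine form of Farkas' lemma, for variables free in sign. The image of \<open>h\<close>
  collects the inequalities implied by nonnegative combinations of the rows, weakened by
  \<open>s\<close>. A vector separating \<open>(a, \<gamma>)\<close> from it would yield a solution
  violating the inequality.\<close>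

lemma farkas_valid_inequality:
  fixes G :: "'a::euclidean_space \<Rightarrow> 'b::ordered_euclidean_space"
  assumes G: "linear G" and x0: "d \<le> G x0"
    and valid: "\<And>x. d \<le> G x \<Longrightarrow> \<gamma> \<le> a \<bullet> x"
  obtains w where "0 \<le> w" "adjoint G w = a" "\<gamma> \<le> w \<bullet> d"
proof -
  define h where "h = (\<lambda>(w, s :: real). (adjoint G w, w \<bullet> d - s))"
  have lin: "linear h"
    by (auto simp: h_def linear_iff linear_add[OF adjoint_linear[OF G]]
        linear_scale[OF adjoint_linear[OF G]] inner_add_left algebra_simps)
  have "(a, \<gamma>) \<in> h ` {z. 0 \<le> z}"
  proof (rule ccontr)
    assume "(a, \<gamma>) \<notin> h ` {z. 0 \<le> z}"
    from farkas_cone[OF lin this] obtain vt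
      where vt: "vt \<bullet> (a, \<gamma>) < 0" "\<And>z. 0 \<le> z \<Longrightarrow> 0 \<le> vt \<bullet> h z" by blast
    obtain v t where "vt = (v, t)" by fastforce
    with vt have v: "v \<bullet> a + t * \<gamma> < 0" and all: "\<And>z. 0 \<le> z \<Longrightarrow> 0 \<le> (v, t) \<bullet> h z" by auto
    have t: "t \<le> 0" using all[of "(0, 1)"]
      by (simp add: h_def zero_prod_def linear_0[OF adjoint_linear[OF G]])
    have "0 \<le> (G v + t *\<^sub>R d) \<bullet> w" if "0 \<le> w" for w
      using all[of "(w, 0)"] that
      by (simp add: h_def zero_prod_def adjoint_clauses[OF G] inner_add_left inner_add_right inner_commute)
    then have Gv: "0 \<le> G v + t *\<^sub>R d" by (subst eucl_nonneg_iff_inner) blast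
    show False
    proof (cases "t = 0")
      case True
      \<comment> \<open>Here \<open>v\<close> is a recession direction along which \<open>a\<close>
        decreases; \<open>k\<close> is chosen so that the value at \<open>x0 + k *\<^sub>R v\<close>
        is \<gamma> - 1.\<close>
      define k where "k = (a \<bullet> x0 - \<gamma> + 1) / - (v \<bullet> a)"
      have va: "v \<bullet> a < 0" using v True by simp
      have "0 \<le> k" unfolding k_def using va valid[OF x0] by (simp add: divide_nonneg_neg)
      have "0 \<le> k *\<^sub>R G v" using Gv True \<open>0 \<le> k\<close> by (intro scaleR_nonneg_nonneg) auto
      then have "d \<le> G (x0 + k *\<^sub>R v)"
        using add_mono[OF x0 \<open>0 \<le> k *\<^sub>R G v\<close>] by (simp add: linear_add[OF G] linear_scale[OF G])
      from valid[OF this] have "\<gamma> \<le> a \<bullet> x0 + k * (v \<bullet> a)"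
        by (simp add: inner_add_right inner_commute)
      also have "k * (v \<bullet> a) = - (a \<bullet> x0 - \<gamma> + 1)" unfolding k_def using va by simp
      finally show False by simp
    next
      case False
      then have t: "t < 0" using t by simp
      \<comment> \<open>For negative \<open>t\<close>, rescaling \<open>v\<close> by
        \<open>1 / - t\<close> already gives a solution of the system whose value is below
        \<gamma>.\<close>
      have "0 \<le> (1 / - t) *\<^sub>R (G v + t *\<^sub>R d)" using t Gv by (intro scaleR_nonneg_nonneg) auto
      also have "\<dots> = G ((1 / - t) *\<^sub>R v) - d"
        using t by (simp add: linear_scale[OF G] scaleR_add_right linear_neg[OF G])
      finally have "d \<le> G ((1 / - t) *\<^sub>R v)" by (simp only: diff_ge_0_iff_ge)
      from valid[OF this] have "\<gamma> \<le> (a \<bullet> v) / - t" by simp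
      then have "\<gamma> * - t \<le> a \<bullet> v" using t by (simp add: field_simps)
      then show False using v by (simp add: inner_commute mult.commute)
    qed
  qed
  then obtain w s where "0 \<le> w" "0 \<le> s" "adjoint G w = a" "w \<bullet> d - s = \<gamma>"
    by (auto simp: h_def zero_prod_def)
  then show thesis by (intro that[of w]) auto
qed

subsection \<open>The epigraph and its cuts\<close>

text \<open>Unlike \<open>epigraph_Q\<close>, this set does not depend on the linear program having an optimum.\<close>

definition lp_epigraph ::
    "real ^ 'n \<Rightarrow> real ^ 'k \<Rightarrow> real ^ 'm \<Rightarrow> real ^ 'k ^ 'm \<Rightarrow> real ^ 'n ^ 'm
      \<Rightarrow> ((real ^ 'n) \<times> real) set" where
  "lp_epigraph f c b A B = {(y, \<eta>). \<exists>x\<ge>0. b - B *v y \<le> A *v x \<and> c \<bullet> x + f \<bullet> y \<le> \<eta>}"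

lemma dual_cone_iff:
  "(\<pi>, \<pi>\<^sub>0) \<in> dual_cone c A \<longleftrightarrow> \<pi> v* A \<le> \<pi>\<^sub>0 *\<^sub>R c \<and> 0 \<le> \<pi> \<and> 0 \<le> \<pi>\<^sub>0"
  by (simp add: dual_cone_def)

lemma inner_mono_nonneg:
  fixes x y w :: "'a::ordered_euclidean_space"
  assumes "0 \<le> w" "x \<le> y"
  shows "w \<bullet> x \<le> w \<bullet> y"
proof -
  have "0 \<le> w \<bullet> (y - x)" using assms eucl_nonneg_iff_inner[of w] by simp
  then show ?thesis by (simp add: inner_diff_right)
qed

lemma dual_value_le:
  fixes A :: "real ^ 'k ^ 'm"
  assumes "0 \<le> \<pi>" "\<pi> v* A \<le> t *\<^sub>R c" "0 \<le> x" "d \<le> A *v x"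
  shows "\<pi> \<bullet> d \<le> t * (c \<bullet> x)"
proof -
  have "\<pi> \<bullet> d \<le> (\<pi> v* A) \<bullet> x" using inner_mono_nonneg[OF assms(1,4)] by (simp add: dot_lmul_matrix)
  also have "\<dots> \<le> (t *\<^sub>R c) \<bullet> x" using inner_mono_nonneg[OF assms(3,2)] by (simp add: inner_commute)
  finally show ?thesis by simp
qed

text \<open>The constraint \<open>0 \<le> x\<close> is treated as further rows, whose multiplier
  \<rho> is the slack in the dual constraint. The conclusion does not mention \<open>d\<close>, so
  boundedness for one right-hand side bounds the program for all of them.\<close>

lemma lp_dual_feasible:
  fixes A :: "real ^ 'k ^ 'm"
  assumes "0 \<le> x0" "d \<le> A *v x0" and bdd: "\<And>x. 0 \<le> x \<Longrightarrow> d \<le> A *v x \<Longrightarrow> \<gamma> \<le> c \<bullet> x"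
  obtains \<pi> where "0 \<le> \<pi>" "\<pi> v* A \<le> c"
proof -
  let ?G = "\<lambda>x. (A *v x, x)"
  have lin: "linear ?G"
    by (simp add: linear_iff matrix_vector_right_distrib matrix_vector_mult_scaleR)
  have adj: "adjoint ?G = (\<lambda>(\<pi>, \<rho>). \<pi> v* A + \<rho>)"
    by (rule adjoint_unique)
      (auto simp: inner_add_right inner_commute simp flip: dot_lmul_matrix)
  have feas: "(d, 0) \<le> ?G x0" using assms by simp
  have "\<gamma> \<le> c \<bullet> x" if "(d, 0) \<le> ?G x" for x using that bdd by simp
  from farkas_valid_inequality[OF lin feas this]
  obtain w where w: "0 \<le> w" "adjoint ?G w = c" by blast
  obtain \<pi> \<rho> where "w = (\<pi>, \<rho>)" by fastforce
  with w have "0 \<le> \<pi>" "0 \<le> \<rho>" "\<pi> v* A + \<rho> = c" by (auto simp: adj zero_prod_def)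
  then show thesis by (intro that[of \<pi>]) auto
qed

text \<open>Points of the epigraph satisfy every cut by weak duality. For a point outside, the
  system in \<open>x\<close> is infeasible, and its Farkas certificate is an element of the dual
  cone whose cut is violated.\<close>

lemma lp_epigraph_eq_Inter:
  "lp_epigraph f c b A B =
    (\<Inter>(\<pi>, \<pi>\<^sub>0) \<in> dual_cone c A. {z. \<pi> \<bullet> b \<le> (\<pi> v* B - \<pi>\<^sub>0 *\<^sub>R f, \<pi>\<^sub>0) \<bullet> z})"
proof -
  have cut: "\<pi> \<bullet> b \<le> (\<pi> v* B - \<pi>\<^sub>0 *\<^sub>R f, \<pi>\<^sub>0) \<bullet> (y, \<eta>)
      \<longleftrightarrow> \<pi> \<bullet> (b - B *v y) + \<pi>\<^sub>0 * (f \<bullet> y - \<eta>) \<le> 0" for \<pi> \<pi>\<^sub>0 y \<eta>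
    by (simp add: inner_diff_right inner_diff_left dot_lmul_matrix algebra_simps)
  have "(y, \<eta>) \<in> lp_epigraph f c b A B \<longleftrightarrow>
      (\<forall>(\<pi>, \<pi>\<^sub>0) \<in> dual_cone c A. \<pi> \<bullet> (b - B *v y) + \<pi>\<^sub>0 * (f \<bullet> y - \<eta>) \<le> 0)" (is "?L \<longleftrightarrow> ?R")
    for y \<eta>
  proof
    assume ?L
    then obtain x where x: "0 \<le> x" "b - B *v y \<le> A *v x" "c \<bullet> x + f \<bullet> y \<le> \<eta>"
      by (auto simp: lp_epigraph_def)
    show ?R
    proof safe
      fix \<pi> \<pi>\<^sub>0 assume "(\<pi>, \<pi>\<^sub>0) \<in> dual_cone c A"
      then have d: "\<pi> v* A \<le> \<pi>\<^sub>0 *\<^sub>R c" "0 \<le> \<pi>" "0 \<le> \<pi>\<^sub>0" by (auto simp: dual_cone_iff)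
      have "\<pi>\<^sub>0 * (c \<bullet> x) \<le> \<pi>\<^sub>0 * (\<eta> - f \<bullet> y)" using x d by (intro mult_left_mono) auto
      with dual_value_le[OF d(2,1) x(1,2)]
      show "\<pi> \<bullet> (b - B *v y) + \<pi>\<^sub>0 * (f \<bullet> y - \<eta>) \<le> 0" by (simp add: algebra_simps)
    qed
  next
    assume R: ?R
    show ?L
    proof (rule ccontr)
      assume "\<not> ?L"
      let ?G = "\<lambda>x. (A *v x, - (c \<bullet> x))"
      have lin: "linear ?G"
        by (simp add: linear_iff matrix_vector_right_distrib matrix_vector_mult_scaleR inner_add_right)
      have adj: "adjoint ?G = (\<lambda>(\<pi>, \<pi>\<^sub>0). \<pi> v* A - \<pi>\<^sub>0 *\<^sub>R c)"
        by (rule adjoint_unique)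
          (auto simp: inner_diff_right inner_commute simp flip: dot_lmul_matrix)
      have inf: "\<nexists>x. 0 \<le> x \<and> (b - B *v y, f \<bullet> y - \<eta>) \<le> ?G x"
        using \<open>\<not> ?L\<close> by (auto simp: lp_epigraph_def)
      obtain w where w: "0 \<le> w" "adjoint ?G w \<le> 0" "0 < w \<bullet> (b - B *v y, f \<bullet> y - \<eta>)"
        using farkas_infeasible[OF lin inf] .
      obtain \<pi> \<pi>\<^sub>0 where p: "w = (\<pi>, \<pi>\<^sub>0)" by fastforce
      with w have "(\<pi>, \<pi>\<^sub>0) \<in> dual_cone c A" by (auto simp: adj zero_prod_def dual_cone_iff)
      with R w(3) p show False by fastforce
    qed
  qed
  then have "z \<in> lp_epigraph f c b A B \<longleftrightarrow>
      (\<forall>(\<pi>, \<pi>\<^sub>0) \<in> dual_cone c A. \<pi> \<bullet> b \<le> (\<pi> v* B - \<pi>\<^sub>0 *\<^sub>R f, \<pi>\<^sub>0) \<bullet> z)" for z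
    by (cases z) (simp only: cut)
  then show ?thesis by auto
qed

lemma closed_lp_epigraph: "closed (lp_epigraph f c b A B)"
  unfolding lp_epigraph_eq_Inter by (intro closed_INT) (auto simp: closed_halfspace_ge)

lemma convex_lp_epigraph: "convex (lp_epigraph f c b A B)"
  unfolding lp_epigraph_eq_Inter by (intro convex_INT) (auto simp: convex_halfspace_ge)

section \<open>Attainment in the linear program and the two forms of the epigraph\<close>

lemma lp_minimum_attained:
  assumes dual: "0 \<le> \<pi>" "\<pi> v* A \<le> c" and y: "y \<in> dom_Q b A B"
  shows "\<exists>v. is_minimum ((\<lambda>x. c \<bullet> x) ` lp_feasible_set b A B y) v"
proof -
  \<comment> \<open>Taking \<open>f = 0\<close> makes the slice at \<open>y\<close> the set of upper
    bounds of feasible costs. It is closed, and bounded below by weak duality, so its infimum is the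
    cost of some feasible \<open>x\<close>.\<close>
  define T where "T = (\<lambda>v. (y, v)) -` lp_epigraph 0 c b A B"
  have T: "v \<in> T \<longleftrightarrow> (\<exists>x\<ge>0. b - B *v y \<le> A *v x \<and> c \<bullet> x \<le> v)" for v
    by (simp add: T_def lp_epigraph_def)
  have "closed T" unfolding T_def
    by (intro continuous_closed_vimage closed_lp_epigraph continuous_intros)
  moreover have "T \<noteq> {}"
    using y by (auto simp: dom_Q_def lp_feasible_set_def set_eq_iff T)
  moreover have bdd: "bdd_below T"
  proof (rule bdd_belowI)
    show "\<pi> \<bullet> (b - B *v y) \<le> v" if "v \<in> T" for v
      using that dual_value_le[OF dual(1), of A 1 c _ "b - B *v y"] dual(2) unfolding T by force
  qed
  ultimately have "Inf T \<in> T" by (intro closed_contains_Inf)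
  then obtain x where x: "0 \<le> x" "b - B *v y \<le> A *v x" "c \<bullet> x \<le> Inf T" unfolding T by blast
  have "is_minimum ((\<lambda>x. c \<bullet> x) ` lp_feasible_set b A B y) (c \<bullet> x)"
    unfolding is_minimum_def
  proof (intro conjI ballI)
    show "c \<bullet> x \<in> (\<lambda>x. c \<bullet> x) ` lp_feasible_set b A B y"
      using x by (auto simp: lp_feasible_set_def)
    fix s assume "s \<in> (\<lambda>x. c \<bullet> x) ` lp_feasible_set b A B y"
    then have "s \<in> T" unfolding T by (auto simp: lp_feasible_set_def)
    then show "c \<bullet> x \<le> s" using cInf_lower[OF _ bdd] x(3) by fastforce
  qed
  then show ?thesis by blast
qed

text \<open>A dual solution ensures that the minimum is attained, so lying above the optimal value
  is the same as lying above the cost of some feasible \<open>x\<close>.\<close>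

lemma epigraph_Q_eq_lp_epigraph:
  assumes dual: "0 \<le> \<pi>" "\<pi> v* A \<le> c"
  shows "epigraph_Q f c b A B = lp_epigraph f c b A B"
proof -
  have "(y, \<eta>) \<in> epigraph_Q f c b A B \<longleftrightarrow> (y, \<eta>) \<in> lp_epigraph f c b A B" for y \<eta>
  proof (cases "y \<in> dom_Q b A B")
    case True
    let ?S = "(\<lambda>x. c \<bullet> x) ` lp_feasible_set b A B y"
    obtain v where v: "is_minimum ?S v" using lp_minimum_attained[OF dual True] by blast
    then have "(THE v. is_minimum ?S v) = v"
      by (intro the_equality) (auto simp: is_minimum_def intro: antisym)
    then have "(y, \<eta>) \<in> epigraph_Q f c b A B \<longleftrightarrow> f \<bullet> y + v \<le> \<eta>"
      using True by (simp add: epigraph_Q_def Q_val_def)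
    also have "\<dots> \<longleftrightarrow> (\<exists>s\<in>?S. f \<bullet> y + s \<le> \<eta>)"
      using v unfolding is_minimum_def by force
    also have "\<dots> \<longleftrightarrow> (y, \<eta>) \<in> lp_epigraph f c b A B"
      by (auto simp: lp_feasible_set_def lp_epigraph_def add.commute)
    finally show ?thesis .
  next
    case False
    then show ?thesis by (auto simp: dom_Q_def lp_feasible_set_def epigraph_Q_def lp_epigraph_def)
  qed
  then show ?thesis by auto
qed

lemma valid_inequality_is_cut:
  fixes f :: "real ^ 'n" and c :: "real ^ 'k" and b :: "real ^ 'm"
  assumes ne: "lp_epigraph f c b A B \<noteq> {}"
    and valid: "\<And>z. z \<in> lp_epigraph f c b A B \<Longrightarrow> \<gamma> \<le> (\<alpha>, \<beta>) \<bullet> z"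
  obtains \<pi> where "(\<pi>, \<beta>) \<in> dual_cone c A" "\<pi> v* B - \<beta> *\<^sub>R f = \<alpha>" "\<gamma> \<le> \<pi> \<bullet> b"
proof -
  let ?G = "\<lambda>(x :: real ^ 'k, y :: real ^ 'n, \<eta> :: real).
    (A *v x + B *v y, x, \<eta> - c \<bullet> x - f \<bullet> y)"
  let ?d = "(b, 0 :: real ^ 'k, 0 :: real)"
  have lin: "linear ?G"
    by (auto simp: linear_iff matrix_vector_right_distrib matrix_vector_mult_scaleR
        inner_add_right algebra_simps)
  have adj: "adjoint ?G = (\<lambda>(\<pi>, \<rho>, \<pi>\<^sub>0). (\<pi> v* A + \<rho> - \<pi>\<^sub>0 *\<^sub>R c, \<pi> v* B - \<pi>\<^sub>0 *\<^sub>R f, \<pi>\<^sub>0))"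
    by (rule adjoint_unique)
      (auto simp: inner_diff_right inner_add_right inner_diff_left inner_add_left
        inner_commute algebra_simps simp flip: dot_lmul_matrix)
  have G: "?d \<le> ?G (x, y, \<eta>) \<longleftrightarrow> 0 \<le> x \<and> b - B *v y \<le> A *v x \<and> c \<bullet> x + f \<bullet> y \<le> \<eta>" for x y \<eta>
    by (auto simp: algebra_simps)
  obtain z where z: "?d \<le> ?G z" using ne G by (auto simp: lp_epigraph_def simp del: prod.case)
  have "\<gamma> \<le> (0, \<alpha>, \<beta>) \<bullet> z" if "?d \<le> ?G z" for z
  proof -
    obtain x y \<eta> where e: "z = (x, y, \<eta>)" by (metis surj_pair)
    have "(y, \<eta>) \<in> lp_epigraph f c b A B"
      using that unfolding e G by (auto simp: lp_epigraph_def)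
    from valid[OF this] show ?thesis by (simp add: e)
  qed
  from farkas_valid_inequality[OF lin z this] obtain w
    where w: "0 \<le> w" "adjoint ?G w = (0, \<alpha>, \<beta>)" "\<gamma> \<le> w \<bullet> ?d" by blast
  obtain \<pi> \<rho> \<pi>\<^sub>0 where e: "w = (\<pi>, \<rho>, \<pi>\<^sub>0)" by (metis surj_pair)
  have "0 \<le> \<pi>" "0 \<le> \<rho>" "0 \<le> \<pi>\<^sub>0" using w(1) by (auto simp: e zero_prod_def)
  moreover have "\<pi> v* A + \<rho> - \<pi>\<^sub>0 *\<^sub>R c = 0" "\<pi> v* B - \<pi>\<^sub>0 *\<^sub>R f = \<alpha>" "\<pi>\<^sub>0 = \<beta>"
    using w(2) by (auto simp: adj e)
  moreover from calculation have "\<beta> *\<^sub>R c - \<pi> v* A = \<rho>" by (simp add: algebra_simps)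
  ultimately have "\<pi> v* A \<le> \<beta> *\<^sub>R c" by (metis diff_ge_0_iff_ge)
  then show thesis
    using that[of \<pi>] w(3) \<open>0 \<le> \<pi>\<close> \<open>0 \<le> \<pi>\<^sub>0\<close> \<open>\<pi>\<^sub>0 = \<beta>\<close> \<open>\<pi> v* B - \<pi>\<^sub>0 *\<^sub>R f = \<alpha>\<close>
    by (auto simp: e dual_cone_iff)
qed

section \<open>Nearest points and separation from balls in the l_q norm\<close>

lemma lp_distance_attained:
  fixes S :: "'a::euclidean_space set"
  assumes q: "1 \<le> q" and "closed S" "S \<noteq> {}"
  obtains x where "x \<in> S" "\<And>y. y \<in> S \<Longrightarrow> lp_norm q (x - z) \<le> lp_norm q (y - z)"
proof -
  obtain s where s: "s \<in> S" using assms by blast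
  \<comment> \<open>All points at least as close as \<open>s\<close> in the l_q norm lie in this
    Euclidean ball, so minimising over a compact set suffices.\<close>
  define R where "R = sqrt DIM('a) * lp_norm q (s - z)"
  have cont: "continuous_on K (\<lambda>x. lp_norm q (x - z))" for K
    by (rule continuous_on_compose2[OF continuous_on_lp_norm[OF q, of UNIV]])
      (auto intro: continuous_intros)
  have *: "norm (x - z) \<le> R" if "lp_norm q (x - z) \<le> lp_norm q (s - z)" for x
    using norm_le_lp_norm[OF q, of "x - z"] that unfolding R_def
    by (meson mult_left_mono order_trans real_sqrt_ge_zero of_nat_0_le_iff)
  have "compact (S \<inter> cball z R)" using assms by (simp add: closed_Int_compact)
  moreover have "s \<in> S \<inter> cball z R"
    using s *[of s] by (simp add: dist_norm norm_minus_commute)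
  ultimately obtain x where x: "x \<in> S \<inter> cball z R"
      "\<And>y. y \<in> S \<inter> cball z R \<Longrightarrow> lp_norm q (x - z) \<le> lp_norm q (y - z)"
    using continuous_attains_inf[OF _ _ cont] by (metis empty_iff)
  show thesis
  proof (rule that)
    show "x \<in> S" using x by simp
    fix y assume y: "y \<in> S"
    show "lp_norm q (x - z) \<le> lp_norm q (y - z)"
    proof (cases "lp_norm q (y - z) \<le> lp_norm q (s - z)")
      case True
      then show ?thesis using x(2)[of y] y * by (simp add: dist_norm norm_minus_commute)
    next
      case False
      then show ?thesis using x(2)[OF \<open>s \<in> S \<inter> cball z R\<close>] by linarith
    qed
  qed
qed

text \<open>A hyperplane separates the convex set from the open l_q ball; the supremum of
  \<open>a\<close> over that ball is \<open>a \<bullet> z + d * lp_norm p a\<close> by sharpness of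
  Hoelder's inequality.\<close>

lemma lp_ball_separation:
  fixes S :: "'a::euclidean_space set"
  assumes pq: "1 \<le> p" "1 \<le> q" "1 / p + 1 / q = 1"
    and S: "convex S" "S \<noteq> {}" and d: "0 < d"
    and dist: "\<And>x. x \<in> S \<Longrightarrow> d \<le> lp_norm q (x - z)"
  obtains a where "a \<noteq> 0" "\<And>x. x \<in> S \<Longrightarrow> a \<bullet> z + d * lp_norm p a \<le> a \<bullet> x"
proof -
  let ?U = "{x. lp_norm q (x - z) < d}"
  have "z \<in> ?U" using d lp_norm_eq_0_iff[OF pq(2), of "0 :: 'a"] by simp
  moreover have "?U \<inter> S = {}" using dist by fastforce
  ultimately obtain a \<gamma> where a: "a \<noteq> 0" "\<And>x. x \<in> ?U \<Longrightarrow> a \<bullet> x \<le> \<gamma>"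
      "\<And>x. x \<in> S \<Longrightarrow> \<gamma> \<le> a \<bullet> x"
    using separating_hyperplane_sets[OF convex_lp_ball[OF pq] S(1) _ S(2)] by blast
  obtain v where v: "a \<bullet> v = lp_norm p a" "lp_norm q v \<le> 1"
    using lp_norm_dual_attained[OF pq] by blast
  \<comment> \<open>The ball is open, so the extremal direction \<open>v\<close> is only scaled by
    \<open>t < d\<close>; the bound for \<open>d\<close> itself follows by density.\<close>
  have "t \<le> (\<gamma> - a \<bullet> z) / lp_norm p a" if t: "0 < t" "t < d" for t
  proof -
    have "lp_norm q (t *\<^sub>R v) \<le> t * 1"
      using t v(2) by (subst lp_norm_scaleR[OF pq(2)]) simp
    then have "z + t *\<^sub>R v \<in> ?U" using t by simp
    from a(2)[OF this] have "t * lp_norm p a \<le> \<gamma> - a \<bullet> z" by (simp add: inner_add_right v(1))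
    then show ?thesis using lp_norm_pos[OF pq(1) a(1)] by (simp add: field_simps)
  qed
  then have "d \<le> (\<gamma> - a \<bullet> z) / lp_norm p a" using dense_le_bounded[OF d] by blast
  then have "a \<bullet> z + d * lp_norm p a \<le> \<gamma>"
    using lp_norm_pos[OF pq(1) a(1)] by (simp add: field_simps)
  then show thesis using that[OF a(1)] a(3) by (meson order_trans)
qed

theorem corollary1:
  fixes f :: "real ^ 'n" and c :: "real ^ 'k" and b :: "real ^ 'm"
    and A :: "real ^ 'k ^ 'm" and B :: "real ^ 'n ^ 'm" and Y :: "(real ^ 'n) set"
    and p q :: ereal and yh :: "real ^ 'n" and \<eta>h :: real
  assumes "Y \<subseteq> {y. \<forall>i. y $ i \<in> \<int>}"
    and "mip_feasible_set b A B Y \<noteq> {}"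
    and "mip_bounded f c b A B Y"
    and "1 \<le> p" and "1 \<le> q" and "1 / p + 1 / q = 1"
    and "(yh, \<eta>h) \<notin> epigraph_Q f c b A B"
  shows "is_maximum (cut_ratios p f c b A B yh \<eta>h) (d_star p f c b A B yh \<eta>h)
    \<and> is_minimum {lp_norm q (y - yh, \<eta> - \<eta>h) | y \<eta>. (y, \<eta>) \<in> epigraph_Q f c b A B \<and> \<eta> \<ge> \<eta>h}
        (d_star p f c b A B yh \<eta>h)
    \<and> d_star p f c b A B yh \<eta>h
        = (INF (y, \<eta>) \<in> epigraph_Q f c b A B. lp_norm q (y - yh, \<eta> - \<eta>h))"
proof -
  note pq = assms(4,5,6)
  let ?E = "epigraph_Q f c b A B"
  let ?zh = "(yh, \<eta>h)"
  obtain x0 y0 where xy0: "y0 \<in> Y" "0 \<le> x0" "b - B *v y0 \<le> A *v x0"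
    using assms(2) by (auto simp: mip_feasible_set_def diff_le_eq)
  obtain m where m: "\<And>x y. (x, y) \<in> mip_feasible_set b A B Y \<Longrightarrow> m \<le> c \<bullet> x + f \<bullet> y"
    using assms(3) by (force simp: mip_bounded_def bdd_below_def)
  \<comment> \<open>Fixing \<open>y0\<close> in the bounded mixed-integer program leaves a bounded
    linear program, which supplies the dual solution \<sigma>.\<close>
  have "m - f \<bullet> y0 \<le> c \<bullet> x" if "0 \<le> x" "b - B *v y0 \<le> A *v x" for x
    using m[of x y0] that xy0(1) by (simp add: mip_feasible_set_def diff_le_eq)
  then obtain \<sigma> where \<sigma>: "0 \<le> \<sigma>" "\<sigma> v* A \<le> c"
    using lp_dual_feasible[OF xy0(2,3)] by blast
  have E: "?E = lp_epigraph f c b A B"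
    by (rule epigraph_Q_eq_lp_epigraph[OF \<sigma>])
  have "(y0, c \<bullet> x0 + f \<bullet> y0) \<in> lp_epigraph f c b A B"
    using xy0 by (auto simp: lp_epigraph_def)
  then have ne: "?E \<noteq> {}" unfolding E by blast
  have clE: "closed ?E" and cvE: "convex ?E"
    by (simp_all add: E closed_lp_epigraph convex_lp_epigraph)
  obtain z where z: "z \<in> ?E" "\<And>w. w \<in> ?E \<Longrightarrow> lp_norm q (z - ?zh) \<le> lp_norm q (w - ?zh)"
    using lp_distance_attained[OF pq(2) clE ne] by blast
  define d where "d = lp_norm q (z - ?zh)"
  have d_le: "d \<le> lp_norm q (y - yh, \<eta> - \<eta>h)" if "(y, \<eta>) \<in> ?E" for y \<eta>
    using z(2)[OF that] by (simp add: d_def)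
  have "z - ?zh \<noteq> 0" using z(1) assms(7) by auto
  then have d: "0 < d" unfolding d_def by (rule lp_norm_pos[OF pq(2)])

  \<comment> \<open>The numerator is the amount by which the given point violates the cut.\<close>
  have ratio: "\<pi> \<bullet> (b - B *v yh) + \<pi>\<^sub>0 * (f \<bullet> yh - \<eta>h)
      = \<pi> \<bullet> b - (\<pi> v* B - \<pi>\<^sub>0 *\<^sub>R f, \<pi>\<^sub>0) \<bullet> ?zh" for \<pi> \<pi>\<^sub>0
    by (simp add: inner_diff_right inner_diff_left dot_lmul_matrix algebra_simps)

  have upper: "r \<le> d" if "r \<in> cut_ratios p f c b A B yh \<eta>h" for r
  proof -
    from that obtain \<pi> \<pi>\<^sub>0 where cone: "(\<pi>, \<pi>\<^sub>0) \<in> dual_cone c A"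
        and nz: "lp_norm p (\<pi> v* B - \<pi>\<^sub>0 *\<^sub>R f, \<pi>\<^sub>0) \<noteq> 0"
        and r: "r = (\<pi> \<bullet> b - (\<pi> v* B - \<pi>\<^sub>0 *\<^sub>R f, \<pi>\<^sub>0) \<bullet> ?zh) / lp_norm p (\<pi> v* B - \<pi>\<^sub>0 *\<^sub>R f, \<pi>\<^sub>0)"
      by (auto simp only: cut_ratios_def ratio mem_Collect_eq)
    let ?a = "(\<pi> v* B - \<pi>\<^sub>0 *\<^sub>R f, \<pi>\<^sub>0)"
    \<comment> \<open>The nearest point \<open>z\<close> satisfies the cut, so the violation is at
      most \<open>?a \<bullet> (z - ?zh)\<close>, to which Hoelder's inequality applies.\<close>
    have "\<pi> \<bullet> b \<le> ?a \<bullet> z" using z(1) cone unfolding E lp_epigraph_eq_Inter by blast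
    then have "\<pi> \<bullet> b - ?a \<bullet> ?zh \<le> ?a \<bullet> (z - ?zh)" by (simp only: inner_diff_right)
    also have "\<dots> \<le> lp_norm p ?a * d" unfolding d_def by (rule inner_le_lp_norm[OF pq])
    finally show ?thesis unfolding r using nz lp_norm_nonneg[of p ?a]
      by (simp add: divide_le_eq mult.commute)
  qed
  have "d \<in> cut_ratios p f c b A B yh \<eta>h"
  proof -
    obtain a where a: "a \<noteq> 0" "\<And>w. w \<in> ?E \<Longrightarrow> a \<bullet> ?zh + d * lp_norm p a \<le> a \<bullet> w"
      using lp_ball_separation[OF pq cvE ne d, of ?zh] z(2) unfolding d_def by blast
    obtain \<alpha> \<beta> where e: "a = (\<alpha>, \<beta>)" by fastforce
    \<comment> \<open>The dominating cut has the same normal \<open>a\<close>, so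
      \<open>lp_norm p a\<close> is its denominator and its ratio is at least
      \<open>d\<close>.\<close>
    obtain \<pi> where \<pi>: "(\<pi>, \<beta>) \<in> dual_cone c A" "\<pi> v* B - \<beta> *\<^sub>R f = \<alpha>"
        "a \<bullet> ?zh + d * lp_norm p a \<le> \<pi> \<bullet> b"
      using valid_inequality_is_cut[of f c b A B _ \<alpha> \<beta>] ne a(2) unfolding E e by metis
    have pos: "0 < lp_norm p a" using lp_norm_pos[OF pq(1) a(1)] .
    let ?r = "(\<pi> \<bullet> b - a \<bullet> ?zh) / lp_norm p a"
    have "?r \<in> cut_ratios p f c b A B yh \<eta>h"
      unfolding cut_ratios_def ratio mem_Collect_eq using \<pi>(1,2) pos e
      by (intro exI[of _ \<pi>] exI[of _ \<beta>]) auto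
    moreover from this have "?r \<le> d" by (rule upper)
    moreover have "d \<le> ?r" using \<pi>(3) pos by (simp add: field_simps)
    ultimately show ?thesis by simp
  qed
  with upper have max: "is_maximum (cut_ratios p f c b A B yh \<eta>h) d"
    by (simp add: is_maximum_def)
  then have dstar: "d_star p f c b A B yh \<eta>h = d"
    unfolding d_star_def by (intro the_equality) (auto simp: is_maximum_def intro: antisym)

  obtain y1 \<eta>1 where z1: "z = (y1, \<eta>1)" by fastforce
  \<comment> \<open>Lifting the last coordinate to at least \<eta>h stays in the epigraph and
    replaces a negative difference by 0, so the constrained problem has the same minimum.\<close>
  have up: "(y1, max \<eta>1 \<eta>h) \<in> ?E" using z(1) by (auto simp: z1 epigraph_Q_def)
  have "lp_norm q (y1 - yh, max \<eta>1 \<eta>h - \<eta>h) \<le> d"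
    unfolding d_def z1 diff_Pair by (intro lp_norm_mono[OF pq(2)]) (auto simp: Basis_prod_def)
  with d_le[OF up] have "lp_norm q (y1 - yh, max \<eta>1 \<eta>h - \<eta>h) = d" by simp
  with up have min: "is_minimum {lp_norm q (y - yh, \<eta> - \<eta>h) | y \<eta>. (y, \<eta>) \<in> ?E \<and> \<eta> \<ge> \<eta>h} d"
    unfolding is_minimum_def using d_le by (auto intro!: exI[of _ y1] exI[of _ "max \<eta>1 \<eta>h"])
  have "(INF (y, \<eta>) \<in> ?E. lp_norm q (y - yh, \<eta> - \<eta>h)) = d"
  proof (rule cInf_eq_minimum)
    show "d \<in> (\<lambda>(y, \<eta>). lp_norm q (y - yh, \<eta> - \<eta>h)) ` ?E"
      using z(1) by (force simp: d_def z1)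
  qed (use d_le in auto)
  with max min show ?thesis by (simp add: dstar)
qed

end
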